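(* Assume that $\Psi$ has finite support of size $d\ge1$, and let $\eta\in(0,1]$. After $T\ge1$ rounds of the CVaR($\eta$) RPOSST$_{\mathrm{SEQ}}$ optimization game (defined in the context), in which the protagonist chooses $m$-size tests according to regret matching$^+$ against a best-response antagonist, the pair consisting of $\tau^*\in\mathcal T^m$ and $\hat\sigma^{t^*}_{\tau^*}\in\triangle^m$ is $\varepsilon$-optimal under the $\eta$-fractile CVaR robustness measure, i.e. $$L_{\mathrm{CVaR}(\eta)}(\hat\sigma^{t^*}_{\tau^*})\le\min_{\tau\in\mathcal T^m,\ \hat\sigma_\tau\in\triangle^m}L_{\mathrm{CVaR}(\eta)}(\hat\sigma_\tau)+\varepsilon,\qquad \varepsilon=\mathcal O\!\left(\sqrt{\tfrac{m}{T}}\right),$$ where the hidden constant depends only on the bound $G$ on the loss subgradients.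
   Context: **Setting.** $\mathcal T$ is a finite set of test cases, $\Pi=\{\pi_1,\dots,\pi_n\}$ a finite set of tuning policies, $A\in\mathbb R^{|\mathcal T|\times n}$ a fixed result matrix ($A_{i,j}$ is the result of policy $\pi_j$ on test case $i$). $\triangle^d$ denotes the simplex of probability vectors in $\mathbb R^d$. $\Psi$ is a probability distribution on $\Pi\times\triangle^{|\mathcal T|}$ (pairs of a policy and a "target distribution" $\sigma$), here supported on $d$ pairs $(\pi_{j_1},\sigma_1),\dots,(\pi_{j_d},\sigma_d)$. $\mathit\Delta:\mathbb R\times\mathbb R\to\mathbb R$ is a convex error function. For $m\ge1$, $\tau=(\tau_1,\dots,\tau_m)\in\mathcal T^m$ and weights $\hat\sigma_\tau\in\triangle^m$, the loss is $$\ell(\hat\sigma_\tau;\pi_j,\sigma)=\mathit\Delta\Big(\sum_{s=1}^m\hat\sigma_\tau(s)A_{\tau_s,j},\ \sum_{i\in\mathcal T}\sigma(i)A_{i,j}\Big).$$ It is convex in $\hat\sigma_\tau$. It is assumed that losses are nonnegative and bounded and that the (chosen) subgradients in $\hat\sigma_\tau$ have $\|\cdot\|_\infty\le G$. **CVaR loss.** Given weights $\hat\sigma_\tau$, order the support pairs so that $\ell(\hat\sigma_\tau;\pi_{j_{(1)}},\sigma_{(1)})\ge\dots\ge\ell(\hat\sigma_\tau;\pi_{j_{(d)}},\sigma_{(d)})$. Define recursively $$\alpha_{(i)}=\min\Big\{\Psi\big((\pi_{j_{(i)}},\sigma_{(i)})\big),\ \eta-\sum_{h<i}\alpha_{(h)}\Big\}.$$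 Then $$L_{\mathrm{CVaR}(\eta)}(\hat\sigma_\tau)=\sum_{i=1}^d\frac{\alpha_{(i)}}{\eta}\,\ell(\hat\sigma_\tau;\pi_{j_{(i)}},\sigma_{(i)}).$$ This is the expected loss over the worst $\eta$-fraction of $\Psi$, i.e. the percentile loss for the measure uniform on the fractiles $[0,\eta]$. **CVaR($\eta$) RPOSST$_{\mathrm{SEQ}}$ optimization game (deterministic).** For each $\tau\in\mathcal T^m$ set $r^0_\tau=\mathbf 0\in\mathbb R^m$. For $t=1,\dots,T$ and every $\tau\in\mathcal T^m$: 1. Set $\hat\sigma^t_\tau=r^{t-1}_\tau/(\mathbf 1^\top r^{t-1}_\tau)$ if $\mathbf 1^\top r^{t-1}_\tau>0$, else $\hat\sigma^t_\tau=\mathbf 1/m$. 2. (Best-response antagonist.) Order the support pairs of $\Psi$ so that $\ell(\hat\sigma^t_\tau;\pi_{j_{(1)}},\sigma_{(1)})\ge\dots\ge\ell(\hat\sigma^t_\tau;\pi_{j_{(d)}},\sigma_{(d)})$ (this ordering depends on $t$ and $\tau$), and set recursively $\alpha_{(i)}=\min\big\{\Psi\big((\pi_{j_{(i)}},\sigma_{(i)})\big),\ \eta-\sum_{h<i}\alpha_{(h)}\big\}$ for $i=1,\dots,d$. Let $v^t_\tau\in\mathbb R^m$ be minus $\sum_{i=1}^d\frac{\alpha_{(i)}}{\eta}$ times the subgradient at $\hat\sigma^t_\tau$ (in the weights) of $\ell(\cdot;\pi_{j_{(i)}},\sigma_{(i)})$. 3. (Regret matching$^+$.) Set $\rho^t_\tau=v^t_\tau-\big((\hat\sigma^t_\tau)^\top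 v^t_\tau\big)\mathbf 1$ and $r^t_\tau=\max\{r^{t-1}_\tau+\rho^t_\tau,0\}$ coordinatewise. Let $L^t=\min_{\tau\in\mathcal T^m}L_{\mathrm{CVaR}(\eta)}(\hat\sigma^t_\tau)$, $t^*\in\arg\min_{t\in\{1,\dots,T\}}L^t$, and let $\tau^*$ attain the minimum defining $L^{t^*}$. *)

theory Defs
  imports "HOL-Probability.Probability_Mass_Function"
begin

definition prob_simplex :: "'i set \<Rightarrow> ('i \<Rightarrow> real) set" where
  "prob_simplex I = {x. (\<forall>i\<in>I. 0 \<le> x i) \<and> (\<forall>i. i \<notin> I \<longrightarrow> x i = 0) \<and> (\<Sum>i\<in>I. x i) = 1}"

definition test_tuples :: "'a set \<Rightarrow> nat \<Rightarrow> 'a list set" where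
  "test_tuples S m = {\<tau>. set \<tau> \<subseteq> S \<and> length \<tau> = m}"

text \<open>Tuple entries and coordinates of weight vectors are indexed from 0: an \<open>m\<close>-dimensional
  vector is a function on \<open>nat\<close> of which only the values below \<open>m\<close> matter.
  \<open>A i j\<close> is the result of policy \<open>j\<close> on test case \<open>i\<close>, and a pair \<open>(j, \<sigma>)\<close> consists of a policy
  and a target distribution on the set \<open>S\<close> of all test cases.\<close>

definition loss ::
  "'a set \<Rightarrow> ('a \<Rightarrow> 'p \<Rightarrow> real) \<Rightarrow> (real \<Rightarrow> real \<Rightarrow> real) \<Rightarrow> 'a list \<Rightarrow> (nat \<Rightarrow> real)
    \<Rightarrow> 'p \<times> ('a \<Rightarrow> real) \<Rightarrow> real" where
  "loss S A \<Delta> \<tau> u = (\<lambda>(j, \<sigma>). \<Delta> (\<Sum>s<length \<tau>. u s * A (\<tau> ! s) j) (\<Sum>i\<in>S. \<sigma> i * A i j))"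

definition worst_first :: "('c \<Rightarrow> real) \<Rightarrow> 'c set \<Rightarrow> 'c list \<Rightarrow> bool" where
  "worst_first f X ps \<longleftrightarrow> distinct ps \<and> set ps = X \<and> sorted_wrt (\<lambda>p q. f p \<ge> f q) ps"

fun cvar_alpha :: "'c pmf \<Rightarrow> real \<Rightarrow> 'c list \<Rightarrow> nat \<Rightarrow> real" where
  "cvar_alpha \<Psi> \<eta> ps i = min (pmf \<Psi> (ps ! i)) (\<eta> - (\<Sum>h<i. cvar_alpha \<Psi> \<eta> ps h))"

declare cvar_alpha.simps [simp del]

text \<open>Any worst-first ordering of the support gives the same value: orderings differ only within
  groups of equal loss, and the total mass allotted to such a group does not depend on the order
  inside it. The choice of an ordering is therefore immaterial.\<close>

definition cvar :: "'c pmf \<Rightarrow> real \<Rightarrow> ('c \<Rightarrow> real) \<Rightarrow> real" where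
  "cvar \<Psi> \<eta> f = (let ps = (SOME ps. worst_first f (set_pmf \<Psi>) ps)
     in \<Sum>i<length ps. cvar_alpha \<Psi> \<eta> ps i / \<eta> * f (ps ! i))"

definition cvar_loss ::
  "'a set \<Rightarrow> ('a \<Rightarrow> 'p \<Rightarrow> real) \<Rightarrow> (real \<Rightarrow> real \<Rightarrow> real) \<Rightarrow> ('p \<times> ('a \<Rightarrow> real)) pmf \<Rightarrow> real
    \<Rightarrow> 'a list \<Rightarrow> (nat \<Rightarrow> real) \<Rightarrow> real" where
  "cvar_loss S A \<Delta> \<Psi> \<eta> \<tau> u = cvar \<Psi> \<eta> (loss S A \<Delta> \<tau> u)"

text \<open>Losses are functions on the simplex of weights, so the subgradient inequality is
  only required there. Every subgradient of the extension to the whole space is one in this sense.\<close>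

definition is_subgradient_on_simplex ::
  "nat \<Rightarrow> ((nat \<Rightarrow> real) \<Rightarrow> real) \<Rightarrow> (nat \<Rightarrow> real) \<Rightarrow> (nat \<Rightarrow> real) \<Rightarrow> bool" where
  "is_subgradient_on_simplex m f u g \<longleftrightarrow>
     (\<forall>w\<in>prob_simplex {..<m}. f u + (\<Sum>s<m. g s * (w s - u s)) \<le> f w)"

text \<open>\<open>u t \<tau>\<close> are the weights played in round \<open>t\<close>, \<open>r t \<tau>\<close> the cumulative clipped regrets after
  round \<open>t\<close>, \<open>ps t \<tau>\<close> the antagonist's ordering of the support and \<open>g t \<tau> p\<close> the chosen
  subgradient of the loss for the pair \<open>p\<close>. The ordering (among ties) and the subgradients may be
  chosen in any way, possibly differently in each round.\<close>

definition rposst_seq_game ::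
  "'a set \<Rightarrow> ('a \<Rightarrow> 'p \<Rightarrow> real) \<Rightarrow> (real \<Rightarrow> real \<Rightarrow> real) \<Rightarrow> ('p \<times> ('a \<Rightarrow> real)) pmf \<Rightarrow> real
    \<Rightarrow> nat \<Rightarrow> nat
    \<Rightarrow> (nat \<Rightarrow> 'a list \<Rightarrow> nat \<Rightarrow> real)
    \<Rightarrow> (nat \<Rightarrow> 'a list \<Rightarrow> nat \<Rightarrow> real)
    \<Rightarrow> (nat \<Rightarrow> 'a list \<Rightarrow> ('p \<times> ('a \<Rightarrow> real)) list)
    \<Rightarrow> (nat \<Rightarrow> 'a list \<Rightarrow> 'p \<times> ('a \<Rightarrow> real) \<Rightarrow> nat \<Rightarrow> real)
    \<Rightarrow> (nat \<Rightarrow> 'a list \<Rightarrow> nat \<Rightarrow> real) \<Rightarrow> bool" where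
  "rposst_seq_game S A \<Delta> \<Psi> \<eta> m T r u ps g v \<longleftrightarrow>
     (\<forall>\<tau>\<in>test_tuples S m.
        (\<forall>s<m. r 0 \<tau> s = 0) \<and>
        (\<forall>t\<in>{1..T}.
           u t \<tau> = (\<lambda>s. if s < m
                        then if (\<Sum>k<m. r (t - 1) \<tau> k) > 0
                             then r (t - 1) \<tau> s / (\<Sum>k<m. r (t - 1) \<tau> k)
                             else 1 / real m
                        else 0) \<and>
           worst_first (loss S A \<Delta> \<tau> (u t \<tau>)) (set_pmf \<Psi>) (ps t \<tau>) \<and>
           (\<forall>p\<in>set_pmf \<Psi>.
              is_subgradient_on_simplex m (\<lambda>w. loss S A \<Delta> \<tau> w p) (u t \<tau>) (g t \<tau> p)) \<and>
           (\<forall>s<m. v t \<tau> s = - (\<Sum>i<card (set_pmf \<Psi>).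
              cvar_alpha \<Psi> \<eta> (ps t \<tau>) i / \<eta> * g t \<tau> (ps t \<tau> ! i) s)) \<and>
           (\<forall>s<m. r t \<tau> s =
              max (r (t - 1) \<tau> s + (v t \<tau> s - (\<Sum>k<m. u t \<tau> k * v t \<tau> k))) 0)))"

definition round_value ::
  "'a set \<Rightarrow> ('a \<Rightarrow> 'p \<Rightarrow> real) \<Rightarrow> (real \<Rightarrow> real \<Rightarrow> real) \<Rightarrow> ('p \<times> ('a \<Rightarrow> real)) pmf \<Rightarrow> real
    \<Rightarrow> nat \<Rightarrow> (nat \<Rightarrow> 'a list \<Rightarrow> nat \<Rightarrow> real) \<Rightarrow> nat \<Rightarrow> real" where
  "round_value S A \<Delta> \<Psi> \<eta> m u t = (MIN \<tau>\<in>test_tuples S m. cvar_loss S A \<Delta> \<Psi> \<eta> \<tau> (u t \<tau>))"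

text \<open>The minimum over all tests and weights is spelled out as an attained value, so
  \<open>\<epsilon>\<close>-optimality includes the existence of a minimizer.\<close>

definition cvar_eps_optimal ::
  "'a set \<Rightarrow> ('a \<Rightarrow> 'p \<Rightarrow> real) \<Rightarrow> (real \<Rightarrow> real \<Rightarrow> real) \<Rightarrow> ('p \<times> ('a \<Rightarrow> real)) pmf \<Rightarrow> real
    \<Rightarrow> nat \<Rightarrow> real \<Rightarrow> 'a list \<Rightarrow> (nat \<Rightarrow> real) \<Rightarrow> bool" where
  "cvar_eps_optimal S A \<Delta> \<Psi> \<eta> m \<epsilon> \<tau> u \<longleftrightarrow>
     \<tau> \<in> test_tuples S m \<and> u \<in> prob_simplex {..<m} \<and>
     (\<exists>\<tau>' u'. is_arg_min (\<lambda>(\<tau>, u). cvar_loss S A \<Delta> \<Psi> \<eta> \<tau> u)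
                (\<lambda>(\<tau>, u). \<tau> \<in> test_tuples S m \<and> u \<in> prob_simplex {..<m}) (\<tau>', u') \<and>
        cvar_loss S A \<Delta> \<Psi> \<eta> \<tau> u \<le> cvar_loss S A \<Delta> \<Psi> \<eta> \<tau>' u' + \<epsilon>)"

end

theory Submission
  imports Defs
begin

text \<open>The greedy weights of the antagonist maximise the linear functional
  \<open>a \<mapsto> (\<Sum>p. a p / \<eta> * f p)\<close> over all \<open>a\<close> with \<open>0 \<le> a \<le> \<Psi>\<close> and total mass \<open>\<eta>\<close>. Hence
  CVaR does not depend on how ties are broken, is continuous in the weights (so that a minimizer
  exists by compactness), and the antagonist's average of subgradients is a subgradient of the CVaR
  loss. Consequently \<open>v\<close> is a negated subgradient with entries bounded by \<open>G\<close>, and the regret of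
  regret matching$^+$ bounds the excess of the average CVaR loss, hence that of the best round. The
  regret bound comes from the potential \<open>\<Sum>s. (r s)\<^sup>2\<close>, which grows by at most \<open>4 * G\<^sup>2 * m\<close> per
  round because the instantaneous regret is orthogonal to the accumulated one.\<close>

section \<open>CVaR as a maximum over reweightings\<close>

text \<open>The feasible set of the dual representation of CVaR, with total mass
  \<open>\<eta>\<close> instead of 1; the factor \<open>1 / \<eta>\<close> appears where the weights
  are applied. Values off the support are left free.\<close>

definition cvar_weights :: "'c pmf \<Rightarrow> real \<Rightarrow> ('c \<Rightarrow> real) set" where
  "cvar_weights \<Psi> \<eta> =
     {a. (\<forall>p\<in>set_pmf \<Psi>. 0 \<le> a p \<and> a p \<le> pmf \<Psi> p) \<and> (\<Sum>p\<in>set_pmf \<Psi>. a p) = \<eta>}"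

text \<open>Each step takes what is available until the budget \<open>\<eta>\<close> is exhausted,
  so partial sums are truncated cumulative masses. This turns the recursion into the closed form
  \<open>cvar_alpha_eq\<close>.\<close>

lemma sum_cvar_alpha:
  assumes "0 \<le> \<eta>"
  shows "(\<Sum>h<i. cvar_alpha \<Psi> \<eta> ps h) = min \<eta> (\<Sum>h<i. pmf \<Psi> (ps ! h))"
proof (induction i)
  case 0
  then show ?case using assms by simp
next
  case (Suc i)
  have "cvar_alpha \<Psi> \<eta> ps i = min (pmf \<Psi> (ps ! i)) (\<eta> - (\<Sum>h<i. cvar_alpha \<Psi> \<eta> ps h))"
    by (rule cvar_alpha.simps)
  moreover have "0 \<le> pmf \<Psi> (ps ! i)"
    by simp
  ultimately show ?case
    unfolding sum.lessThan_Suc Suc.IH by linarith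
qed

lemma cvar_alpha_eq:
  assumes "0 \<le> \<eta>"
  shows "cvar_alpha \<Psi> \<eta> ps i = min (pmf \<Psi> (ps ! i)) (\<eta> - min \<eta> (\<Sum>h<i. pmf \<Psi> (ps ! h)))"
  by (subst cvar_alpha.simps) (simp add: sum_cvar_alpha[OF assms])

lemma cvar_alpha_nonneg: "0 \<le> \<eta> \<Longrightarrow> 0 \<le> cvar_alpha \<Psi> \<eta> ps i"
  by (simp add: cvar_alpha_eq)

lemma cvar_alpha_le_pmf: "0 \<le> \<eta> \<Longrightarrow> cvar_alpha \<Psi> \<eta> ps i \<le> pmf \<Psi> (ps ! i)"
  by (simp add: cvar_alpha_eq)

section \<open>Worst-first orderings as enumerations of the support\<close>

lemma ex_worst_first:
  assumes "finite X"
  shows "\<exists>ps. worst_first f X ps"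
proof -
  obtain xs where xs: "set xs = X" "distinct xs"
    using finite_distinct_list[OF assms] by blast
  let ?ps = "sort_key (\<lambda>p. - f p) xs"
  have "sorted (map (\<lambda>p. - f p) ?ps)"
    by (rule sorted_sort_key)
  then have "worst_first f X ?ps"
    using xs by (simp add: worst_first_def sorted_wrt_map)
  then show ?thesis ..
qed

lemma worst_first_bij_betw:
  assumes "worst_first f X ps"
  shows "bij_betw ((!) ps) {..<length ps} X"
  using assms by (intro bij_betw_nth) (auto simp: worst_first_def)

lemma sum_worst_first:
  assumes "worst_first f X ps"
  shows "(\<Sum>i<length ps. h (ps ! i)) = sum h X"
  by (rule sum.reindex_bij_betw[OF worst_first_bij_betw[OF assms]])

lemma worst_first_nth_mem: "worst_first f X ps \<Longrightarrow> i < length ps \<Longrightarrow> ps ! i \<in> X"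
  by (auto simp: worst_first_def)

lemma length_worst_first: "worst_first f X ps \<Longrightarrow> length ps = card X"
  by (metis worst_first_def distinct_card)

section \<open>Optimality of the greedy allocation\<close>

lemma sum_cvar_alpha_eq:
  assumes "finite (set_pmf \<Psi>)" "0 < \<eta>" "\<eta> \<le> 1" "worst_first f (set_pmf \<Psi>) ps"
  shows "(\<Sum>i<length ps. cvar_alpha \<Psi> \<eta> ps i) = \<eta>"
  using assms sum_worst_first[OF assms(4), of "pmf \<Psi>"]
  by (simp add: sum_cvar_alpha sum_pmf_eq_1)

text \<open>A fractional knapsack problem with values \<open>f\<close>, capacities
  \<open>pmf \<Psi>\<close> and budget \<open>\<eta>\<close>. Both allocations spend the same
  budget, so a constant may be subtracted from \<open>f\<close>; for a suitable threshold every term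
  of the difference then has the right sign.\<close>

lemma cvar_alpha_maximal:
  assumes fin: "finite (set_pmf \<Psi>)" and \<eta>: "0 < \<eta>" "\<eta> \<le> 1"
    and wf: "worst_first f (set_pmf \<Psi>) ps" and a: "a \<in> cvar_weights \<Psi> \<eta>"
  shows "(\<Sum>p\<in>set_pmf \<Psi>. a p * f p) \<le> (\<Sum>i<length ps. cvar_alpha \<Psi> \<eta> ps i * f (ps ! i))"
proof -
  let ?d = "length ps" and ?\<alpha> = "cvar_alpha \<Psi> \<eta> ps"
  define M where "M i = (\<Sum>h<i. pmf \<Psi> (ps ! h))" for i
  have \<alpha>: "?\<alpha> i = min (pmf \<Psi> (ps ! i)) (\<eta> - min \<eta> (M i))" for i
    using cvar_alpha_eq[of \<eta> \<Psi> ps i] \<eta> by (simp add: M_def)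
  have M_Suc: "M (Suc i) = M i + pmf \<Psi> (ps ! i)" for i
    by (simp add: M_def)
  have M_mono: "M i \<le> M j" if "i \<le> j" for i j
    unfolding M_def using that by (intro sum_mono2) auto
  have "M ?d = 1"
    using sum_worst_first[OF wf, of "pmf \<Psi>"] fin by (simp add: M_def sum_pmf_eq_1)
  \<comment> \<open>The mass \<open>\<eta>\<close> runs out at index \<open>k\<close>: the greedy weights are maximal before it and zero
    after it, so \<open>f (ps ! k)\<close> serves as a threshold for an exchange argument.\<close>
  define k where "k = (LEAST k. \<eta> \<le> M (Suc k))"
  have d: "0 < ?d"
    using \<open>M ?d = 1\<close> by (cases ?d) (auto simp: M_def)
  then have ex: "\<eta> \<le> M (Suc (?d - 1))"
    using \<open>M ?d = 1\<close> \<eta> by simp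
  have k: "\<eta> \<le> M (Suc k)" and k_le: "k \<le> ?d - 1"
    unfolding k_def using ex by (auto intro: LeastI Least_le)
  have before: "?\<alpha> i = pmf \<Psi> (ps ! i)" if "i < k" for i
  proof -
    have "M (Suc i) < \<eta>"
      using not_less_Least[of i "\<lambda>k. \<eta> \<le> M (Suc k)"] that by (simp add: k_def)
    moreover have "0 \<le> pmf \<Psi> (ps ! i)"
      by simp
    ultimately show ?thesis
      unfolding \<alpha> M_Suc by linarith
  qed
  have after: "?\<alpha> i = 0" if "k < i" for i
    using M_mono[of "Suc k" i] that k by (simp add: \<alpha>)
  have sorted: "f (ps ! j) \<le> f (ps ! i)" if "i \<le> j" "j < ?d" for i j
    using wf that by (cases "i = j") (auto simp: worst_first_def sorted_wrt_iff_nth_less)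
  have a_bounds: "0 \<le> a (ps ! i)" "a (ps ! i) \<le> pmf \<Psi> (ps ! i)" if "i < ?d" for i
    using a worst_first_nth_mem[OF wf that] by (auto simp: cvar_weights_def)
  let ?c = "f (ps ! k)"
  \<comment> \<open>Before \<open>k\<close> the greedy weight is at least \<open>a\<close> and the
    loss is at least \<open>?c\<close>; after \<open>k\<close> both comparisons reverse; at
    \<open>k\<close> the second factor is zero.\<close>
  have "(a (ps ! i) - ?\<alpha> i) * (f (ps ! i) - ?c) \<le> 0" if "i < ?d" for i
  proof (cases i k rule: linorder_cases)
    case less
    then show ?thesis
      using before a_bounds[OF that] sorted[of i k] k_le d by (intro mult_nonpos_nonneg) auto
  next
    case greater
    then show ?thesis
      using after a_bounds[OF that] sorted[of k i] that by (intro mult_nonneg_nonpos) auto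
  qed simp
  then have "(\<Sum>i<?d. (a (ps ! i) - ?\<alpha> i) * (f (ps ! i) - ?c)) \<le> 0"
    by (intro sum_nonpos) auto
  also have "(\<Sum>i<?d. (a (ps ! i) - ?\<alpha> i) * (f (ps ! i) - ?c)) =
      (\<Sum>i<?d. a (ps ! i) * f (ps ! i)) - (\<Sum>i<?d. ?\<alpha> i * f (ps ! i))
        - ?c * ((\<Sum>i<?d. a (ps ! i)) - (\<Sum>i<?d. ?\<alpha> i))"
    by (simp add: algebra_simps sum_subtractf sum.distrib sum_distrib_left)
  \<comment> \<open>Equal budgets cancel the threshold term.\<close>
  also have "(\<Sum>i<?d. a (ps ! i)) = (\<Sum>i<?d. ?\<alpha> i)"
    using sum_worst_first[OF wf, of a] a sum_cvar_alpha_eq[OF fin \<eta> wf]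
    by (simp add: cvar_weights_def)
  finally show ?thesis
    using sum_worst_first[OF wf, of "\<lambda>p. a p * f p"] by simp
qed

text \<open>Moves the greedy weights from positions in a list to elements of the support, so that
  weights built from one ordering can be tested against another loss or ordering.\<close>

lemma cvar_alpha_as_weights:
  assumes "finite (set_pmf \<Psi>)" "0 < \<eta>" "\<eta> \<le> 1" and wf: "worst_first f (set_pmf \<Psi>) ps"
  obtains a where "a \<in> cvar_weights \<Psi> \<eta>" "\<And>i. i < length ps \<Longrightarrow> a (ps ! i) = cvar_alpha \<Psi> \<eta> ps i"
proof -
  note bij = worst_first_bij_betw[OF wf]
  define a where "a = cvar_alpha \<Psi> \<eta> ps \<circ> inv_into {..<length ps} ((!) ps)"
  have a_nth: "a (ps ! i) = cvar_alpha \<Psi> \<eta> ps i" if "i < length ps" for i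
    using bij_betw_inv_into_left[OF bij, of i] that by (simp add: a_def)
  have "0 \<le> a p \<and> a p \<le> pmf \<Psi> p" if p: "p \<in> set_pmf \<Psi>" for p
  proof -
    obtain i where i: "i < length ps" "ps ! i = p"
      using p wf by (metis in_set_conv_nth worst_first_def)
    show ?thesis
      using a_nth[OF i(1)] i(2) cvar_alpha_nonneg[of \<eta> \<Psi> ps i] cvar_alpha_le_pmf[of \<eta> \<Psi> ps i]
        assms(2) by simp
  qed
  moreover have "sum a (set_pmf \<Psi>) = \<eta>"
    using sum_worst_first[OF wf, of a] sum_cvar_alpha_eq[OF assms] a_nth by simp
  ultimately have "a \<in> cvar_weights \<Psi> \<eta>"
    by (simp add: cvar_weights_def)
  then show ?thesis
    using that a_nth by blast
qed

text \<open>Replaces the ordering picked by \<open>SOME\<close> with any other, in particular the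
  antagonist's. The greedy weights of each ordering are feasible competitors for the other, so the
  two values bound each other.\<close>

lemma cvar_eq_worst_first:
  assumes "finite (set_pmf \<Psi>)" "0 < \<eta>" "\<eta> \<le> 1" and wf: "worst_first f (set_pmf \<Psi>) ps"
  shows "cvar \<Psi> \<eta> f = (\<Sum>i<length ps. cvar_alpha \<Psi> \<eta> ps i / \<eta> * f (ps ! i))"
proof -
  have le: "(\<Sum>i<length qs. cvar_alpha \<Psi> \<eta> qs i * f (qs ! i))
      \<le> (\<Sum>i<length qs'. cvar_alpha \<Psi> \<eta> qs' i * f (qs' ! i))"
    if qs: "worst_first f (set_pmf \<Psi>) qs" and qs': "worst_first f (set_pmf \<Psi>) qs'" for qs qs'
  proof -
    obtain a where a: "a \<in> cvar_weights \<Psi> \<eta>"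
      "\<And>i. i < length qs \<Longrightarrow> a (qs ! i) = cvar_alpha \<Psi> \<eta> qs i"
      using cvar_alpha_as_weights[OF assms(1-3) qs] by blast
    then show ?thesis
      using sum_worst_first[OF qs, of "\<lambda>p. a p * f p"]
        cvar_alpha_maximal[OF assms(1-3) qs' a(1)] by simp
  qed
  define qs where "qs = (SOME qs. worst_first f (set_pmf \<Psi>) qs)"
  have "worst_first f (set_pmf \<Psi>) qs"
    unfolding qs_def using wf by (rule someI)
  then have "(\<Sum>i<length qs. cvar_alpha \<Psi> \<eta> qs i * f (qs ! i))
      = (\<Sum>i<length ps. cvar_alpha \<Psi> \<eta> ps i * f (ps ! i))"
    using le wf by (intro antisym) auto
  then have "(\<Sum>i<length qs. cvar_alpha \<Psi> \<eta> qs i * f (qs ! i)) / \<eta>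
      = (\<Sum>i<length ps. cvar_alpha \<Psi> \<eta> ps i * f (ps ! i)) / \<eta>"
    by simp
  then show ?thesis
    by (simp add: cvar_def sum_divide_distrib flip: qs_def)
qed

section \<open>Perturbation and continuity of CVaR\<close>

lemma cvar_ge_weights:
  assumes "finite (set_pmf \<Psi>)" "0 < \<eta>" "\<eta> \<le> 1" "a \<in> cvar_weights \<Psi> \<eta>"
  shows "(\<Sum>p\<in>set_pmf \<Psi>. a p / \<eta> * f p) \<le> cvar \<Psi> \<eta> f"
proof -
  obtain ps where ps: "worst_first f (set_pmf \<Psi>) ps"
    using ex_worst_first[OF assms(1)] by blast
  have "(\<Sum>p\<in>set_pmf \<Psi>. a p * f p) / \<eta>
      \<le> (\<Sum>i<length ps. cvar_alpha \<Psi> \<eta> ps i * f (ps ! i)) / \<eta>"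
    using cvar_alpha_maximal[OF assms(1-3) ps assms(4)] assms(2) by (intro divide_right_mono) auto
  then show ?thesis
    using cvar_eq_worst_first[OF assms(1-3) ps] by (simp add: sum_divide_distrib)
qed

text \<open>The greedy weights for \<open>f\<close> stay feasible for \<open>h\<close>, even if
  \<open>h\<close> orders the support differently. They sum to 1 after division by
  \<open>\<eta>\<close>, so the shift \<open>e\<close> passes through unscaled. Used in both
  directions, this makes CVaR 1-Lipschitz in the maximum norm.\<close>

lemma cvar_le_shift:
  assumes "finite (set_pmf \<Psi>)" "0 < \<eta>" "\<eta> \<le> 1"
    and le: "\<And>p. p \<in> set_pmf \<Psi> \<Longrightarrow> f p \<le> h p + e"
  shows "cvar \<Psi> \<eta> f \<le> cvar \<Psi> \<eta> h + e"
proof -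
  obtain ps where ps: "worst_first f (set_pmf \<Psi>) ps"
    using ex_worst_first[OF assms(1)] by blast
  obtain a where a: "a \<in> cvar_weights \<Psi> \<eta>"
    "\<And>i. i < length ps \<Longrightarrow> a (ps ! i) = cvar_alpha \<Psi> \<eta> ps i"
    using cvar_alpha_as_weights[OF assms(1-3) ps] by blast
  have "cvar \<Psi> \<eta> f = (\<Sum>p\<in>set_pmf \<Psi>. a p / \<eta> * f p)"
    using cvar_eq_worst_first[OF assms(1-3) ps] a(2) sum_worst_first[OF ps, of "\<lambda>p. a p / \<eta> * f p"]
    by simp
  also have "\<dots> \<le> (\<Sum>p\<in>set_pmf \<Psi>. a p / \<eta> * (h p + e))"
    using a(1) assms(2) le by (intro sum_mono mult_left_mono) (auto simp: cvar_weights_def)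
  also have "\<dots> = (\<Sum>p\<in>set_pmf \<Psi>. a p / \<eta> * h p) + (\<Sum>p\<in>set_pmf \<Psi>. a p) / \<eta> * e"
    by (simp add: distrib_left sum.distrib sum_distrib_right sum_divide_distrib)
  also have "\<dots> \<le> cvar \<Psi> \<eta> h + e"
    using cvar_ge_weights[OF assms(1-3) a(1), of h] a(1) assms(2) by (simp add: cvar_weights_def)
  finally show ?thesis .
qed

lemma continuous_on_cvar:
  assumes "finite (set_pmf \<Psi>)" "0 < \<eta>" "\<eta> \<le> 1"
    and cont: "\<And>p. p \<in> set_pmf \<Psi> \<Longrightarrow> continuous_on K (\<lambda>u. F u p)"
  shows "continuous_on K (\<lambda>u. cvar \<Psi> \<eta> (F u))"
  unfolding continuous_on_def
proof (intro ballI tendstoI)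
  fix x and e :: real
  assume x: "x \<in> K" and e: "0 < e"
  \<comment> \<open>Halving \<open>e\<close> leaves room for the non-strict bound of
    \<open>cvar_le_shift\<close>; finiteness of the support then gives one neighbourhood for all
    \<open>p\<close>.\<close>
  have "\<forall>p\<in>set_pmf \<Psi>. \<forall>\<^sub>F u in at x within K. dist (F u p) (F x p) < e / 2"
    using cont x half_gt_zero[OF e] by (intro ballI tendstoD) (auto simp: continuous_on_def)
  then have "\<forall>\<^sub>F u in at x within K. \<forall>p\<in>set_pmf \<Psi>. dist (F u p) (F x p) < e / 2"
    using assms(1) by (simp add: eventually_ball_finite_distrib)
  then show "\<forall>\<^sub>F u in at x within K. dist (cvar \<Psi> \<eta> (F u)) (cvar \<Psi> \<eta> (F x)) < e"
  proof (rule eventually_mono)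
    fix u
    assume u: "\<forall>p\<in>set_pmf \<Psi>. dist (F u p) (F x p) < e / 2"
    have "F u p \<le> F x p + e / 2" "F x p \<le> F u p + e / 2" if "p \<in> set_pmf \<Psi>" for p
      using bspec[OF u that] unfolding dist_real_def by linarith+
    then have "cvar \<Psi> \<eta> (F u) \<le> cvar \<Psi> \<eta> (F x) + e / 2" "cvar \<Psi> \<eta> (F x) \<le> cvar \<Psi> \<eta> (F u) + e / 2"
      by (intro cvar_le_shift[OF assms(1-3)]; simp)+
    then show "dist (cvar \<Psi> \<eta> (F u)) (cvar \<Psi> \<eta> (F x)) < e"
      using e unfolding dist_real_def by linarith
  qed
qed

section \<open>Existence of optimal weights\<close>

lemma compact_prob_simplex:
  assumes "finite I"
  shows "compact (prob_simplex I)"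
proof -
  \<comment> \<open>Coordinates outside \<open>I\<close> are pinned by the singleton factor 0, so
    the box is compact by Tychonoff even for an infinite index type.\<close>
  let ?B = "PiE UNIV (\<lambda>i. if i \<in> I then {0..1} else {0::real})"
  have "compactin (product_topology (\<lambda>i. euclidean) UNIV) ?B"
    by (subst compactin_PiE) auto
  then have "compact ?B"
    by (simp add: euclidean_product_topology)
  moreover have "closed {x. (\<Sum>i\<in>I. x i) = (1::real)}"
    by (intro closed_Collect_eq continuous_on_sum continuous_on_product_coordinates
        continuous_on_const)
  moreover have "prob_simplex I = ?B \<inter> {x. (\<Sum>i\<in>I. x i) = 1}"
  proof -
    have "x i \<le> 1" if "\<forall>i\<in>I. 0 \<le> x i" "(\<Sum>i\<in>I. x i) = 1" "i \<in> I" for x :: "'a \<Rightarrow> real" and i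
      using member_le_sum[of i I x] that assms by simp
    then show ?thesis
      by (fastforce simp: prob_simplex_def PiE_iff split: if_splits)
  qed
  ultimately show ?thesis
    by (simp add: compact_Int_closed)
qed

text \<open>A finite convex function on the whole plane is continuous; here it is composed with a
  map whose first component is linear in \<open>u\<close> and whose second is constant.\<close>

lemma continuous_on_loss:
  assumes "convex_on UNIV (\<lambda>(x, y). \<Delta> x y)"
  shows "continuous_on K (\<lambda>u. loss S A \<Delta> \<tau> u p)"
proof -
  have \<Delta>: "continuous_on UNIV (\<lambda>(x, y). \<Delta> x y)"
    using assms by (intro convex_on_continuous) auto
  have "continuous_on K (\<lambda>u. (case (\<Sum>s<length \<tau>. u s * A (\<tau> ! s) (fst p), \<Sum>i\<in>S. snd p i * A i (fst p))
      of (x, y) \<Rightarrow> \<Delta> x y))"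
    by (rule continuous_on_compose2[OF \<Delta>])
      (auto intro!: continuous_intros continuous_on_subset[OF continuous_on_product_coordinates])
  then show ?thesis
    by (simp add: loss_def case_prod_beta)
qed

lemma finite_test_tuples: "finite S \<Longrightarrow> finite (test_tuples S m)"
  using finite_lists_length_eq[of S m] by (simp add: test_tuples_def)

text \<open>Minimisation in two stages: compactness gives optimal weights \<open>w \<tau>\<close>
  for each test, and finitely many tests remain to be compared.\<close>

lemma ex_min_cvar_loss:
  assumes "finite S" "convex_on UNIV (\<lambda>(x, y). \<Delta> x y)" "finite (set_pmf \<Psi>)" "0 < \<eta>" "\<eta> \<le> 1"
    and "test_tuples S m \<noteq> {}" "prob_simplex {..<m} \<noteq> {}"
  obtains \<tau>' u' where "is_arg_min (\<lambda>(\<tau>, u). cvar_loss S A \<Delta> \<Psi> \<eta> \<tau> u)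
    (\<lambda>(\<tau>, u). \<tau> \<in> test_tuples S m \<and> u \<in> prob_simplex {..<m}) (\<tau>', u')"
proof -
  have cont: "continuous_on (prob_simplex {..<m}) (cvar_loss S A \<Delta> \<Psi> \<eta> \<tau>)" for \<tau>
    unfolding cvar_loss_def using assms(2-5) by (intro continuous_on_cvar continuous_on_loss)
  have "\<exists>x\<in>prob_simplex {..<m}. \<forall>y\<in>prob_simplex {..<m}.
      cvar_loss S A \<Delta> \<Psi> \<eta> \<tau> x \<le> cvar_loss S A \<Delta> \<Psi> \<eta> \<tau> y" for \<tau>
    by (rule continuous_attains_inf[OF compact_prob_simplex assms(7) cont]) simp
  then obtain w where w: "\<And>\<tau>. w \<tau> \<in> prob_simplex {..<m}"
    "\<And>\<tau> y. y \<in> prob_simplex {..<m} \<Longrightarrow> cvar_loss S A \<Delta> \<Psi> \<eta> \<tau> (w \<tau>) \<le> cvar_loss S A \<Delta> \<Psi> \<eta> \<tau> y"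
    by metis
  obtain \<tau>' where \<tau>': "is_arg_min (\<lambda>\<tau>. cvar_loss S A \<Delta> \<Psi> \<eta> \<tau> (w \<tau>)) (\<lambda>\<tau>. \<tau> \<in> test_tuples S m) \<tau>'"
    using ex_is_arg_min_if_finite[OF finite_test_tuples[OF assms(1)] assms(6)] by blast
  show ?thesis
  proof (rule that[of \<tau>' "w \<tau>'"])
    show "is_arg_min (\<lambda>(\<tau>, u). cvar_loss S A \<Delta> \<Psi> \<eta> \<tau> u)
        (\<lambda>(\<tau>, u). \<tau> \<in> test_tuples S m \<and> u \<in> prob_simplex {..<m}) (\<tau>', w \<tau>')"
      unfolding is_arg_min_linorder
    proof (clarsimp, intro conjI allI impI)
      show "\<tau>' \<in> test_tuples S m" "w \<tau>' \<in> prob_simplex {..<m}"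
        using \<tau>' w(1) by (simp_all add: is_arg_min_def)
      fix \<tau> y
      assume \<tau>: "\<tau> \<in> test_tuples S m \<and> y \<in> prob_simplex {..<m}"
      then have "cvar_loss S A \<Delta> \<Psi> \<eta> \<tau>' (w \<tau>') \<le> cvar_loss S A \<Delta> \<Psi> \<eta> \<tau> (w \<tau>)"
        using \<tau>' by (simp add: is_arg_min_linorder)
      also have "\<dots> \<le> cvar_loss S A \<Delta> \<Psi> \<eta> \<tau> y"
        using w(2) \<tau> by simp
      finally show "cvar_loss S A \<Delta> \<Psi> \<eta> \<tau>' (w \<tau>') \<le> cvar_loss S A \<Delta> \<Psi> \<eta> \<tau> y" .
    qed
  qed
qed

section \<open>Regret matching$^+$\<close>

text \<open>The weight rule of the game as a function of the current regrets alone, so that regret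
  matching can be analysed apart from tests and losses.\<close>

definition rm_plus_weights :: "nat \<Rightarrow> (nat \<Rightarrow> real) \<Rightarrow> nat \<Rightarrow> real" where
  "rm_plus_weights m R = (\<lambda>s. if s < m
     then if (\<Sum>k<m. R k) > 0 then R s / (\<Sum>k<m. R k) else 1 / real m else 0)"

lemma rm_plus_weights_in_simplex:
  assumes "1 \<le> m" "\<And>s. s < m \<Longrightarrow> 0 \<le> R s"
  shows "rm_plus_weights m R \<in> prob_simplex {..<m}"
proof (cases "(\<Sum>k<m. R k) > 0")
  case True
  then have "(\<Sum>s<m. R s / (\<Sum>k<m. R k)) = 1"
    by (simp flip: sum_divide_distrib)
  then show ?thesis
    using True assms by (auto simp: rm_plus_weights_def prob_simplex_def)
next
  case False
  then show ?thesis
    using assms by (auto simp: rm_plus_weights_def prob_simplex_def)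
qed

text \<open>The Blackwell condition. If the total regret is positive, \<open>R\<close> is a multiple
  of the weights, under which the instantaneous regret averages to zero; otherwise \<open>R\<close>
  vanishes.\<close>

lemma rm_plus_orthogonal:
  assumes "\<And>s. s < m \<Longrightarrow> 0 \<le> R s"
  shows "(\<Sum>s<m. R s * (v s - (\<Sum>k<m. rm_plus_weights m R k * v k))) = 0"
proof (cases "(\<Sum>k<m. R k) > 0")
  case True
  then have "(\<Sum>k<m. rm_plus_weights m R k * v k) = (\<Sum>k<m. R k * v k) / (\<Sum>k<m. R k)"
    by (simp add: rm_plus_weights_def sum_divide_distrib)
  then show ?thesis
    using True by (simp only: right_diff_distrib sum_subtractf flip: sum_distrib_right) simp
next
  case False
  then have "(\<Sum>k<m. R k) = 0"
    using assms by (meson lessThan_iff not_less order_antisym sum_nonneg)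
  then have "R s = 0" if "s < m" for s
    using assms that by (subst (asm) sum_nonneg_eq_0_iff) auto
  then show ?thesis
    by simp
qed

lemma rm_plus_regret:
  fixes r v :: "nat \<Rightarrow> nat \<Rightarrow> real"
  assumes m: "1 \<le> m" and G: "0 \<le> G" and r0: "\<And>s. s < m \<Longrightarrow> r 0 s = 0"
    and u: "\<And>t. t < T \<Longrightarrow> u (Suc t) = rm_plus_weights m (r t)"
    and r: "\<And>t s. t < T \<Longrightarrow> s < m \<Longrightarrow>
      r (Suc t) s = max (r t s + (v (Suc t) s - (\<Sum>k<m. u (Suc t) k * v (Suc t) k))) 0"
    and v: "\<And>t s. t < T \<Longrightarrow> s < m \<Longrightarrow> \<bar>v (Suc t) s\<bar> \<le> G"
    and w: "w \<in> prob_simplex {..<m}"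
  shows "(\<Sum>t<T. \<Sum>s<m. v (Suc t) s * (w s - u (Suc t) s)) \<le> 2 * G * sqrt (real m * real T)"
proof -
  \<comment> \<open>Index shift: \<open>\<rho> t\<close> is the instantaneous regret of round
    \<open>Suc t\<close>, the one added to \<open>r t\<close>.\<close>
  define \<rho> where "\<rho> t s = v (Suc t) s - (\<Sum>k<m. u (Suc t) k * v (Suc t) k)" for t s
  have r_Suc: "r (Suc t) s = max (r t s + \<rho> t s) 0" if "t < T" "s < m" for t s
    using r[OF that] by (simp add: \<rho>_def)
  have r_nonneg: "0 \<le> r t s" if "t \<le> T" "s < m" for t s
    using that r0 r_Suc by (cases t) auto
  have u_simplex: "u (Suc t) \<in> prob_simplex {..<m}" if "t < T" for t
    using rm_plus_weights_in_simplex[OF m, of "r t"] r_nonneg that u by simp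
  \<comment> \<open>One \<open>G\<close> for the entry of \<open>v\<close>, another for its average
    under the weights.\<close>
  have \<rho>_bound: "\<bar>\<rho> t s\<bar> \<le> 2 * G" if "t < T" "s < m" for t s
  proof -
    have "\<bar>\<Sum>k<m. u (Suc t) k * v (Suc t) k\<bar> \<le> (\<Sum>k<m. \<bar>u (Suc t) k * v (Suc t) k\<bar>)"
      by (rule sum_abs)
    also have "\<dots> \<le> (\<Sum>k<m. u (Suc t) k * G)"
      using u_simplex[OF that(1)] v[OF that(1)]
      by (intro sum_mono) (auto simp: abs_mult prob_simplex_def intro!: mult_left_mono)
    also have "\<dots> = G"
      using u_simplex[OF that(1)] by (simp add: prob_simplex_def flip: sum_distrib_right)
    finally show ?thesis
      using v[OF that] unfolding \<rho>_def by linarith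
  qed
  have potential: "(\<Sum>s<m. (r t s)\<^sup>2) \<le> real t * real m * (2 * G)\<^sup>2" if "t \<le> T" for t
    using that
  proof (induction t)
    case 0
    then show ?case using r0 by simp
  next
    case (Suc t)
    have "(r (Suc t) s)\<^sup>2 \<le> (r t s)\<^sup>2 + 2 * (r t s * \<rho> t s) + (2 * G)\<^sup>2" if "s < m" for s
    proof -
      \<comment> \<open>Clipping at 0 either keeps the number or replaces it by 0, so the square
        does not grow.\<close>
      have "(r (Suc t) s)\<^sup>2 \<le> (r t s + \<rho> t s)\<^sup>2"
        using r_Suc[of t s] Suc.prems that by (auto simp: max_def)
      also have "\<dots> = (r t s)\<^sup>2 + 2 * (r t s * \<rho> t s) + (\<rho> t s)\<^sup>2"
        by (simp add: power2_sum)
      also have "(\<rho> t s)\<^sup>2 \<le> (2 * G)\<^sup>2"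
        using \<rho>_bound[of t s] Suc.prems that by (intro power2_le_iff_abs_le[THEN iffD2]) (use G in auto)
      finally show ?thesis by simp
    qed
    then have "(\<Sum>s<m. (r (Suc t) s)\<^sup>2)
        \<le> (\<Sum>s<m. (r t s)\<^sup>2 + 2 * (r t s * \<rho> t s) + (2 * G)\<^sup>2)"
      by (intro sum_mono) auto
    also have "\<dots> = (\<Sum>s<m. (r t s)\<^sup>2) + 2 * (\<Sum>s<m. r t s * \<rho> t s) + real m * (2 * G)\<^sup>2"
      by (simp add: sum.distrib sum_distrib_left)
    also have "(\<Sum>s<m. r t s * \<rho> t s) = 0"
      using rm_plus_orthogonal[of m "r t" "v (Suc t)"] r_nonneg[of t] u[of t] Suc.prems
      by (simp add: \<rho>_def)
    finally show ?case
      using Suc by (simp add: algebra_simps)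
  qed
  \<comment> \<open>Clipping only raises values, so \<open>r\<close> dominates the unclipped
    cumulative regret.\<close>
  have cumulative: "(\<Sum>t<n. \<rho> t s) \<le> r n s" if "s < m" "n \<le> T" for n s
    using that(2)
  proof (induction n)
    case 0
    then show ?case using r0 that by simp
  next
    case (Suc n)
    then show ?case using r_Suc[of n s] that(1) by simp
  qed
  have w_sum: "(\<Sum>s<m. w s) = 1" and w_nonneg: "\<And>s. s < m \<Longrightarrow> 0 \<le> w s"
    using w by (auto simp: prob_simplex_def)
  \<comment> \<open>Since \<open>w\<close> has total mass 1, the linearised gain over
    \<open>u\<close> is the \<open>w\<close>-average of the instantaneous regrets.\<close>
  have "(\<Sum>s<m. v (Suc t) s * (w s - u (Suc t) s)) = (\<Sum>s<m. w s * \<rho> t s)" for t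
  proof -
    have "(\<Sum>s<m. w s * (\<Sum>k<m. u (Suc t) k * v (Suc t) k)) = (\<Sum>k<m. u (Suc t) k * v (Suc t) k)"
      by (simp add: w_sum flip: sum_distrib_right)
    then show ?thesis
      by (simp add: \<rho>_def right_diff_distrib sum_subtractf mult.commute)
  qed
  then have "(\<Sum>t<T. \<Sum>s<m. v (Suc t) s * (w s - u (Suc t) s)) = (\<Sum>t<T. \<Sum>s<m. w s * \<rho> t s)"
    by simp
  also have "\<dots> = (\<Sum>s<m. w s * (\<Sum>t<T. \<rho> t s))"
    by (subst sum.swap) (simp add: sum_distrib_left)
  also have "\<dots> \<le> (\<Sum>s<m. w s * (2 * G * sqrt (real m * real T)))"
  proof (intro sum_mono mult_left_mono)
    fix s
    assume "s \<in> {..<m}"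
    then have s: "s < m" by simp
    show "0 \<le> w s"
      by (rule w_nonneg[OF s])
    \<comment> \<open>A single coordinate is bounded by the Euclidean norm, that is, by the root of
      the potential.\<close>
    have "(r T s)\<^sup>2 \<le> (\<Sum>s<m. (r T s)\<^sup>2)"
      using s by (intro member_le_sum) auto
    also have "\<dots> \<le> real T * real m * (2 * G)\<^sup>2"
      by (rule potential) simp
    also have "\<dots> = (2 * G * sqrt (real m * real T))\<^sup>2"
      by (simp add: power_mult_distrib)
    finally have "r T s \<le> 2 * G * sqrt (real m * real T)"
      by (rule power2_le_imp_le) (use G in auto)
    then show "(\<Sum>t<T. \<rho> t s) \<le> 2 * G * sqrt (real m * real T)"
      using cumulative[OF s, of T] by simp
  qed
  also have "\<dots> = 2 * G * sqrt (real m * real T)"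
    by (simp add: w_sum flip: sum_distrib_right)
  finally show ?thesis .
qed

section \<open>The game\<close>

text \<open>An envelope argument: the antagonist's weights attain CVaR at \<open>u\<close> and are
  merely feasible at \<open>w\<close>, so freezing them gives equality at \<open>u\<close> and a
  lower bound at \<open>w\<close>.\<close>

lemma cvar_loss_subgradient:
  assumes "finite (set_pmf \<Psi>)" "0 < \<eta>" "\<eta> \<le> 1"
    and wf: "worst_first (loss S A \<Delta> \<tau> u) (set_pmf \<Psi>) ps"
    and g: "\<And>p. p \<in> set_pmf \<Psi> \<Longrightarrow> is_subgradient_on_simplex m (\<lambda>w. loss S A \<Delta> \<tau> w p) u (g p)"
  shows "is_subgradient_on_simplex m (cvar_loss S A \<Delta> \<Psi> \<eta> \<tau>) u
    (\<lambda>s. \<Sum>i<length ps. cvar_alpha \<Psi> \<eta> ps i / \<eta> * g (ps ! i) s)"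
  unfolding is_subgradient_on_simplex_def
proof
  fix w
  assume w: "w \<in> prob_simplex {..<m}"
  let ?d = "length ps" and ?c = "\<lambda>i. cvar_alpha \<Psi> \<eta> ps i / \<eta>"
  obtain a where a: "a \<in> cvar_weights \<Psi> \<eta>"
    "\<And>i. i < ?d \<Longrightarrow> a (ps ! i) = cvar_alpha \<Psi> \<eta> ps i"
    using cvar_alpha_as_weights[OF assms(1-3) wf] by blast
  have "(\<Sum>s<m. (\<Sum>i<?d. ?c i * g (ps ! i) s) * (w s - u s))
      = (\<Sum>i<?d. ?c i * (\<Sum>s<m. g (ps ! i) s * (w s - u s)))"
    unfolding sum_distrib_right sum_distrib_left by (subst sum.swap) (simp add: mult.assoc)
  then have "cvar_loss S A \<Delta> \<Psi> \<eta> \<tau> u + (\<Sum>s<m. (\<Sum>i<?d. ?c i * g (ps ! i) s) * (w s - u s))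
      = (\<Sum>i<?d. ?c i * (loss S A \<Delta> \<tau> u (ps ! i) + (\<Sum>s<m. g (ps ! i) s * (w s - u s))))"
    using cvar_eq_worst_first[OF assms(1-3) wf]
    by (simp add: cvar_loss_def distrib_left sum.distrib)
  also have "\<dots> \<le> (\<Sum>i<?d. ?c i * loss S A \<Delta> \<tau> w (ps ! i))"
  proof (intro sum_mono mult_left_mono)
    fix i
    assume "i \<in> {..<?d}"
    then have "ps ! i \<in> set_pmf \<Psi>"
      using worst_first_nth_mem[OF wf] by simp
    then show "loss S A \<Delta> \<tau> u (ps ! i) + (\<Sum>s<m. g (ps ! i) s * (w s - u s))
        \<le> loss S A \<Delta> \<tau> w (ps ! i)"
      using g w by (auto simp: is_subgradient_on_simplex_def)
  qed (use assms(2) cvar_alpha_nonneg[of \<eta> \<Psi> ps] in auto)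
  also have "\<dots> = (\<Sum>p\<in>set_pmf \<Psi>. a p / \<eta> * loss S A \<Delta> \<tau> w p)"
    using a(2) sum_worst_first[OF wf, of "\<lambda>p. a p / \<eta> * loss S A \<Delta> \<tau> w p"] by simp
  also have "\<dots> \<le> cvar_loss S A \<Delta> \<Psi> \<eta> \<tau> w"
    unfolding cvar_loss_def by (rule cvar_ge_weights[OF assms(1-3) a(1)])
  finally show "cvar_loss S A \<Delta> \<Psi> \<eta> \<tau> u
      + (\<Sum>s<m. (\<Sum>i<?d. ?c i * g (ps ! i) s) * (w s - u s)) \<le> cvar_loss S A \<Delta> \<Psi> \<eta> \<tau> w" .
qed

text \<open>The coefficients \<open>cvar_alpha / \<eta>\<close> are nonnegative and sum to 1, so
  this is a convex combination.\<close>

lemma cvar_average_bound: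
  assumes "finite (set_pmf \<Psi>)" "0 < \<eta>" "\<eta> \<le> 1"
    and wf: "worst_first f (set_pmf \<Psi>) ps"
    and g: "\<And>p. p \<in> set_pmf \<Psi> \<Longrightarrow> \<bar>h p\<bar> \<le> (G::real)"
  shows "\<bar>\<Sum>i<length ps. cvar_alpha \<Psi> \<eta> ps i / \<eta> * h (ps ! i)\<bar> \<le> G"
proof -
  have "\<bar>\<Sum>i<length ps. cvar_alpha \<Psi> \<eta> ps i / \<eta> * h (ps ! i)\<bar>
      \<le> (\<Sum>i<length ps. \<bar>cvar_alpha \<Psi> \<eta> ps i / \<eta> * h (ps ! i)\<bar>)"
    by (rule sum_abs)
  also have "\<dots> \<le> (\<Sum>i<length ps. cvar_alpha \<Psi> \<eta> ps i / \<eta> * G)"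
  proof (rule sum_mono)
    fix i
    assume "i \<in> {..<length ps}"
    then have "\<bar>h (ps ! i)\<bar> \<le> G"
      using worst_first_nth_mem[OF wf] g by simp
    then show "\<bar>cvar_alpha \<Psi> \<eta> ps i / \<eta> * h (ps ! i)\<bar> \<le> cvar_alpha \<Psi> \<eta> ps i / \<eta> * G"
      using cvar_alpha_nonneg[of \<eta> \<Psi> ps i] assms(2) unfolding abs_mult
      by (intro mult_mono) auto
  qed
  also have "\<dots> = G"
    using sum_cvar_alpha_eq[OF assms(1-3) wf] assms(2)
    by (simp flip: sum_distrib_right sum_divide_distrib)
  finally show ?thesis .
qed

text \<open>The subgradient inequality linearises the excess CVaR loss of each round; summed over
  the rounds, the linear terms are the regret of \<open>rm_plus_regret\<close>. Every test is
  treated separately.\<close>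

lemma rposst_seq_game_regret:
  assumes fin: "finite (set_pmf \<Psi>)" and \<eta>: "0 < \<eta>" "\<eta> \<le> 1" and m: "1 \<le> m"
    and game: "rposst_seq_game S A \<Delta> \<Psi> \<eta> m T r u ps g v"
    and G: "\<And>t p s. t \<in> {1..T} \<Longrightarrow> p \<in> set_pmf \<Psi> \<Longrightarrow> s < m \<Longrightarrow> \<bar>g t \<tau> p s\<bar> \<le> G" "0 \<le> G"
    and \<tau>: "\<tau> \<in> test_tuples S m"
  shows "\<And>t. t \<in> {1..T} \<Longrightarrow> u t \<tau> \<in> prob_simplex {..<m}"
    and "\<And>w. w \<in> prob_simplex {..<m} \<Longrightarrow>
      (\<Sum>t=1..T. cvar_loss S A \<Delta> \<Psi> \<eta> \<tau> (u t \<tau>))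
        \<le> real T * cvar_loss S A \<Delta> \<Psi> \<eta> \<tau> w + 2 * G * sqrt (real m * real T)"
proof -
  note game' = bspec[OF game[unfolded rposst_seq_game_def] \<tau>]
  have r0: "r 0 \<tau> s = 0" if "s < m" for s
    using game' that by blast
  have round: "u (Suc t) \<tau> = rm_plus_weights m (r t \<tau>)"
    "worst_first (loss S A \<Delta> \<tau> (u (Suc t) \<tau>)) (set_pmf \<Psi>) (ps (Suc t) \<tau>)"
    "\<And>p. p \<in> set_pmf \<Psi> \<Longrightarrow>
       is_subgradient_on_simplex m (\<lambda>w. loss S A \<Delta> \<tau> w p) (u (Suc t) \<tau>) (g (Suc t) \<tau> p)"
    "\<And>s. s < m \<Longrightarrow> v (Suc t) \<tau> s = - (\<Sum>i<card (set_pmf \<Psi>).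
       cvar_alpha \<Psi> \<eta> (ps (Suc t) \<tau>) i / \<eta> * g (Suc t) \<tau> (ps (Suc t) \<tau> ! i) s)"
    "\<And>s. s < m \<Longrightarrow> r (Suc t) \<tau> s
       = max (r t \<tau> s + (v (Suc t) \<tau> s - (\<Sum>k<m. u (Suc t) \<tau> k * v (Suc t) \<tau> k))) 0"
    if "t < T" for t
    using bspec[OF conjunct2[OF game'], of "Suc t"] that by (auto simp: rm_plus_weights_def)
  have r_nonneg: "0 \<le> r t \<tau> s" if "t \<le> T" "s < m" for t s
    using that r0 round(5) by (cases t) auto
  show "u t \<tau> \<in> prob_simplex {..<m}" if "t \<in> {1..T}" for t
    using rm_plus_weights_in_simplex[OF m, of "r (t - 1) \<tau>"] r_nonneg[of "t - 1"] that
      round(1)[of "t - 1"] by force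
  fix w
  assume w: "w \<in> prob_simplex {..<m}"
  have v_bound: "\<bar>v (Suc t) \<tau> s\<bar> \<le> G" if "t < T" "s < m" for t s
    using cvar_average_bound[OF fin \<eta> round(2)[OF that(1)],
        of "\<lambda>p. g (Suc t) \<tau> p s" G] G(1) that
    by (simp add: round(4) length_worst_first[OF round(2)[OF that(1)]])
  \<comment> \<open>As \<open>v\<close> is minus a subgradient, the linear term changes sign when
    moved to the right.\<close>
  have "cvar_loss S A \<Delta> \<Psi> \<eta> \<tau> (u (Suc t) \<tau>)
      \<le> cvar_loss S A \<Delta> \<Psi> \<eta> \<tau> w + (\<Sum>s<m. v (Suc t) \<tau> s * (w s - u (Suc t) \<tau> s))"
    if "t < T" for t
    using that cvar_loss_subgradient[OF fin \<eta> round(2)[OF that] round(3)[OF that],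
        unfolded is_subgradient_on_simplex_def, rule_format, OF _ w]
    by (simp add: round(4) length_worst_first[OF round(2)[OF that]] sum_negf)
  then have "(\<Sum>t<T. cvar_loss S A \<Delta> \<Psi> \<eta> \<tau> (u (Suc t) \<tau>))
      \<le> (\<Sum>t<T. cvar_loss S A \<Delta> \<Psi> \<eta> \<tau> w + (\<Sum>s<m. v (Suc t) \<tau> s * (w s - u (Suc t) \<tau> s)))"
    by (intro sum_mono) auto
  also have "\<dots> = real T * cvar_loss S A \<Delta> \<Psi> \<eta> \<tau> w
      + (\<Sum>t<T. \<Sum>s<m. v (Suc t) \<tau> s * (w s - u (Suc t) \<tau> s))"
    by (simp add: sum.distrib)
  also have "(\<Sum>t<T. \<Sum>s<m. v (Suc t) \<tau> s * (w s - u (Suc t) \<tau> s)) \<le> 2 * G * sqrt (real m * real T)"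
    by (rule rm_plus_regret[OF m G(2), of "\<lambda>t. r t \<tau>" T "\<lambda>t. u t \<tau>" "\<lambda>t. v t \<tau>" w])
      (use r0 round(1,5) v_bound w in auto)
  finally show "(\<Sum>t=1..T. cvar_loss S A \<Delta> \<Psi> \<eta> \<tau> (u t \<tau>))
      \<le> real T * cvar_loss S A \<Delta> \<Psi> \<eta> \<tau> w + 2 * G * sqrt (real m * real T)"
    by (simp add: sum.atLeast1_atMost_eq)
qed

theorem corollary4p2:
  "\<exists>C :: real \<Rightarrow> real.
     \<forall>(S :: 'a set) (P :: 'p set) (A :: 'a \<Rightarrow> 'p \<Rightarrow> real) (\<Delta> :: real \<Rightarrow> real \<Rightarrow> real)
      (\<Psi> :: ('p \<times> ('a \<Rightarrow> real)) pmf) (\<eta> :: real) (m :: nat) (T :: nat) (G :: real)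
      (r :: nat \<Rightarrow> 'a list \<Rightarrow> nat \<Rightarrow> real) (u :: nat \<Rightarrow> 'a list \<Rightarrow> nat \<Rightarrow> real)
      (ps :: nat \<Rightarrow> 'a list \<Rightarrow> ('p \<times> ('a \<Rightarrow> real)) list)
      (g :: nat \<Rightarrow> 'a list \<Rightarrow> 'p \<times> ('a \<Rightarrow> real) \<Rightarrow> nat \<Rightarrow> real)
      (v :: nat \<Rightarrow> 'a list \<Rightarrow> nat \<Rightarrow> real) (tstar :: nat) (\<tau>star :: 'a list).
       finite S \<and> finite P \<and>
       convex_on UNIV (\<lambda>(x, y). \<Delta> x y) \<and>
       finite (set_pmf \<Psi>) \<and> set_pmf \<Psi> \<subseteq> P \<times> prob_simplex S \<and>
       0 < \<eta> \<and> \<eta> \<le> 1 \<and> 1 \<le> m \<and> 1 \<le> T \<and>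
       (\<forall>\<tau>\<in>test_tuples S m. \<forall>w\<in>prob_simplex {..<m}. \<forall>p\<in>set_pmf \<Psi>. 0 \<le> loss S A \<Delta> \<tau> w p) \<and>
       (\<exists>B. \<forall>\<tau>\<in>test_tuples S m. \<forall>w\<in>prob_simplex {..<m}. \<forall>p\<in>set_pmf \<Psi>. loss S A \<Delta> \<tau> w p \<le> B) \<and>
       rposst_seq_game S A \<Delta> \<Psi> \<eta> m T r u ps g v \<and>
       (\<forall>t\<in>{1..T}. \<forall>\<tau>\<in>test_tuples S m. \<forall>p\<in>set_pmf \<Psi>. \<forall>s<m. \<bar>g t \<tau> p s\<bar> \<le> G) \<and>
       is_arg_min (round_value S A \<Delta> \<Psi> \<eta> m u) (\<lambda>t. t \<in> {1..T}) tstar \<and>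
       \<tau>star \<in> test_tuples S m \<and>
       cvar_loss S A \<Delta> \<Psi> \<eta> \<tau>star (u tstar \<tau>star) = round_value S A \<Delta> \<Psi> \<eta> m u tstar
       \<longrightarrow> cvar_eps_optimal S A \<Delta> \<Psi> \<eta> m (C G * sqrt (real m / real T))
             \<tau>star (u tstar \<tau>star)"
\<comment> \<open>The factor 2 is that of the regret bound \<open>2 * G * sqrt (m * T)\<close>,
  later divided by \<open>T\<close>.\<close>
proof (intro exI[of _ "\<lambda>G. 2 * G"] allI impI, elim conjE)
  fix S :: "'a set" and P :: "'p set" and A \<Delta> and \<Psi> :: "('p \<times> ('a \<Rightarrow> real)) pmf"
    and \<eta> G :: real and m T :: nat and r u ps g v tstar \<tau>star
  assume S: "finite S" and \<Delta>: "convex_on UNIV (\<lambda>(x, y). \<Delta> x y)"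
    and fin: "finite (set_pmf \<Psi>)" and \<eta>: "0 < \<eta>" "\<eta> \<le> 1" and m: "1 \<le> m" and T: "1 \<le> T"
    and game: "rposst_seq_game S A \<Delta> \<Psi> \<eta> m T r u ps g v"
    and G: "\<forall>t\<in>{1..T}. \<forall>\<tau>\<in>test_tuples S m. \<forall>p\<in>set_pmf \<Psi>. \<forall>s<m. \<bar>g t \<tau> p s\<bar> \<le> G"
    and tstar: "is_arg_min (round_value S A \<Delta> \<Psi> \<eta> m u) (\<lambda>t. t \<in> {1..T}) tstar"
    and \<tau>star: "\<tau>star \<in> test_tuples S m"
    and min: "cvar_loss S A \<Delta> \<Psi> \<eta> \<tau>star (u tstar \<tau>star) = round_value S A \<Delta> \<Psi> \<eta> m u tstar"
  let ?L = "cvar_loss S A \<Delta> \<Psi> \<eta>"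
  \<comment> \<open>The sign of \<open>G\<close> comes from an actual subgradient entry: the support
    is nonempty, round 1 exists since \<open>1 \<le> T\<close>, and coordinate 0 exists since
    \<open>1 \<le> m\<close>.\<close>
  obtain p where "p \<in> set_pmf \<Psi>"
    using set_pmf_not_empty[of \<Psi>] by blast
  then have "\<bar>g 1 \<tau>star p 0\<bar> \<le> G"
    using G T m \<tau>star by simp
  then have G0: "0 \<le> G"
    by linarith
  have regret: "t \<in> {1..T} \<Longrightarrow> u t \<tau> \<in> prob_simplex {..<m}"
    "w \<in> prob_simplex {..<m} \<Longrightarrow>
      (\<Sum>t=1..T. ?L \<tau> (u t \<tau>)) \<le> real T * ?L \<tau> w + 2 * G * sqrt (real m * real T)"
    if \<tau>: "\<tau> \<in> test_tuples S m" for t w \<tau>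
    using rposst_seq_game_regret[OF fin \<eta> m game _ G0 \<tau>] G \<tau> by blast+
  have tstar_in: "tstar \<in> {1..T}"
    and tstar_le: "\<And>t. t \<in> {1..T} \<Longrightarrow> round_value S A \<Delta> \<Psi> \<eta> m u tstar \<le> round_value S A \<Delta> \<Psi> \<eta> m u t"
    using tstar by (auto simp: is_arg_min_linorder)
  have u_in: "u tstar \<tau>star \<in> prob_simplex {..<m}"
    using regret(1)[OF \<tau>star] tstar_in by blast
  obtain \<tau>' u' where opt: "is_arg_min (\<lambda>(\<tau>, u). ?L \<tau> u)
      (\<lambda>(\<tau>, u). \<tau> \<in> test_tuples S m \<and> u \<in> prob_simplex {..<m}) (\<tau>', u')"
    using ex_min_cvar_loss[OF S \<Delta> fin \<eta>, of m] \<tau>star u_in by blast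
  then have \<tau>': "\<tau>' \<in> test_tuples S m" and u': "u' \<in> prob_simplex {..<m}"
    by (auto simp: is_arg_min_def)
  \<comment> \<open>The game is played for every test at once, so the iterates of the optimal
    \<open>\<tau>'\<close> are available, and the selected pair is at least as good as each of
    them.\<close>
  have "?L \<tau>star (u tstar \<tau>star) \<le> ?L \<tau>' (u t \<tau>')" if "t \<in> {1..T}" for t
  proof -
    have "round_value S A \<Delta> \<Psi> \<eta> m u t \<le> ?L \<tau>' (u t \<tau>')"
      unfolding round_value_def using \<tau>' finite_test_tuples[OF S] by (intro Min_le) auto
    then show ?thesis
      using min tstar_le[OF that] by linarith
  qed
  \<comment> \<open>The best value is at most the average along \<open>\<tau>'\<close>, which the
    regret bound compares with the optimum \<open>u'\<close>.\<close>
  then have "(\<Sum>t=1..T. ?L \<tau>star (u tstar \<tau>star)) \<le> (\<Sum>t=1..T. ?L \<tau>' (u t \<tau>'))"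
    by (rule sum_mono)
  also have "\<dots> \<le> real T * ?L \<tau>' u' + 2 * G * sqrt (real m * real T)"
    by (rule regret(2)[OF \<tau>' u'])
  also have "sqrt (real m * real T) = real T * sqrt (real m / real T)"
    using T by (simp add: real_sqrt_mult real_sqrt_divide field_simps)
  finally have "real T * ?L \<tau>star (u tstar \<tau>star)
      \<le> real T * (?L \<tau>' u' + 2 * G * sqrt (real m / real T))"
    by (simp add: algebra_simps)
  then have "?L \<tau>star (u tstar \<tau>star) \<le> ?L \<tau>' u' + 2 * G * sqrt (real m / real T)"
    using T by simp
  then show "cvar_eps_optimal S A \<Delta> \<Psi> \<eta> m (2 * G * sqrt (real m / real T)) \<tau>star (u tstar \<tau>star)"
    unfolding cvar_eps_optimal_def using \<tau>star u_in opt by blast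
qed

end
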